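(* Let $X$ be a ($T_0$) topological space. The free paratopological group $FP(X)$ is a $P$-space if and only if $X$ is a $P$-space; likewise, the free Abelian paratopological group $AP(X)$ is a $P$-space if and only if $X$ is a $P$-space.
   Context: All spaces are assumed to be $T_0$. A paratopological group is a group with a topology such that the multiplication $G\times G\to G$ is jointly continuous. The Markov free paratopological group $FP(X)$ on $X$ is a paratopological group $G$ containing $X$ as a topological subspace such that (1) $X$ generates $G$ algebraically, and (2) each continuous mapping $f:X\to H$ to a paratopological group $H$ extends to a continuous homomorphism $\hat f:G\to H$. The Markov free Abelian paratopological group $AP(X)$ is defined in the same way with all groups Abelian. As abstract groups, $FP(X)$ is the free group and $AP(X)$ is the free Abelian group on the set $X$. A space is called a $P$-space if each of its $G_\delta$-subsets is open. *)

theory Defs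
  imports "HOL-Analysis.Analysis" "HOL-Algebra.Generated_Groups" "HOL-Algebra.Elementary_Groups" "HOL-Algebra.Product_Groups"
begin

definition P_space :: "'a topology \<Rightarrow> bool" where
  "P_space X \<longleftrightarrow> (\<forall>S. gdelta_in X S \<longrightarrow> openin X S)"

text \<open>All spaces are assumed to be \<open>T\<^sub>0\<close>, so this is part of being a paratopological group,
  both for the free object and for the groups against which it is tested below.\<close>

definition paratopological_group :: "'g monoid \<Rightarrow> 'g topology \<Rightarrow> bool" where
  "paratopological_group G T \<longleftrightarrow>
     group G \<and> topspace T = carrier G \<and> t0_space T \<and>
     continuous_map (prod_topology T T) T (\<lambda>(x, y). x \<otimes>\<^bsub>G\<^esub> y)"

text \<open>\<open>X\<close> is contained in \<open>G\<close> by means of the topological embedding \<open>e\<close>.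

  A formula cannot quantify over types, so the universal property is required of the groups \<open>H\<close>
  whose elements have the type \<open>('a \<times> bool) list\<close> of words in letters from \<open>'a\<close> and their formal
  inverses.  This is no restriction: a map \<open>f : X \<rightarrow> H\<close> only involves the subgroup of \<open>H\<close> generated
  by \<open>f(X)\<close>, whose elements are values of such words.  Lemmas \<open>markov_free_universal\<close> and
  \<open>markov_free_abelian_universal\<close> below derive the universal property for groups over an
  arbitrary type; existence is shown in \<open>markov_free_exists\<close> and \<open>markov_free_abelian_exists\<close>.\<close>

definition markov_free_paratopological_group ::
    "'a topology \<Rightarrow> 'g monoid \<Rightarrow> 'g topology \<Rightarrow> ('a \<Rightarrow> 'g) \<Rightarrow> bool" where
  "markov_free_paratopological_group X G T e \<longleftrightarrow>
     paratopological_group G T \<and>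
     embedding_map X T e \<and>
     generate G (e ` topspace X) = carrier G \<and>
     (\<forall>(H :: ('a \<times> bool) list monoid) S f.
        paratopological_group H S \<and> continuous_map X S f \<longrightarrow>
        (\<exists>h \<in> hom G H. continuous_map T S h \<and> (\<forall>x \<in> topspace X. h (e x) = f x)))"

definition markov_free_abelian_paratopological_group ::
    "'a topology \<Rightarrow> 'g monoid \<Rightarrow> 'g topology \<Rightarrow> ('a \<Rightarrow> 'g) \<Rightarrow> bool" where
  "markov_free_abelian_paratopological_group X A T e \<longleftrightarrow>
     paratopological_group A T \<and> comm_group A \<and>
     embedding_map X T e \<and>
     generate A (e ` topspace X) = carrier A \<and>
     (\<forall>(H :: ('a \<times> bool) list monoid) S f.
        paratopological_group H S \<and> comm_group H \<and> continuous_map X S f \<longrightarrow>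
        (\<exists>h \<in> hom A H. continuous_map T S h \<and> (\<forall>x \<in> topspace X. h (e x) = f x)))"

lemma paratopological_group_pullback:
  assumes H: "paratopological_group H S" and K: "group K"
    and k: "k \<in> hom K H" and inj: "inj_on k (carrier K)"
  shows "paratopological_group K (pullback_topology (carrier K) k S)"
proof -
  let ?P = "pullback_topology (carrier K) k S"
  have tS: "topspace S = carrier H" and t0: "t0_space S"
    and m: "continuous_map (prod_topology S S) S (\<lambda>(x, y). x \<otimes>\<^bsub>H\<^esub> y)"
    using H by (auto simp: paratopological_group_def)
  have tP: "topspace ?P = carrier K"
    using k by (auto simp: topspace_pullback_topology tS hom_def)
  have ck: "continuous_map ?P S k"
    using continuous_map_pullback[OF continuous_map_id, of "carrier K" k S] by (simp add: id_def o_def)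
  have "t0_space ?P"
    unfolding t0_space_def tP
  proof (intro ballI impI)
    fix x y assume xy: "x \<in> carrier K" "y \<in> carrier K" "x \<noteq> y"
    then have "k x \<noteq> k y" "k x \<in> topspace S" "k y \<in> topspace S"
      using inj k by (auto simp: inj_on_def hom_def tS)
    then obtain U where U: "openin S U" "k x \<notin> U \<longleftrightarrow> k y \<in> U"
      using t0 unfolding t0_space_def by blast
    then have "openin ?P (k -` U \<inter> carrier K)"
      by (auto simp: openin_pullback_topology)
    then show "\<exists>U. openin ?P U \<and> (x \<notin> U) = (y \<in> U)"
      using xy U by blast
  qed
  moreover have "continuous_map (prod_topology ?P ?P) ?P (\<lambda>(x, y). x \<otimes>\<^bsub>K\<^esub> y)"
  proof (rule continuous_map_pullback')
    have "continuous_map (prod_topology ?P ?P) S ((\<lambda>(x, y). x \<otimes>\<^bsub>H\<^esub> y) \<circ> (\<lambda>(x, y). (k x, k y)))"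
      by (rule continuous_map_compose[OF _ m])
         (auto simp: continuous_map_prod_top ck)
    then show "continuous_map (prod_topology ?P ?P) S (k \<circ> (\<lambda>(x, y). x \<otimes>\<^bsub>K\<^esub> y))"
      by (rule continuous_map_eq) (use k in \<open>auto simp: tP hom_def\<close>)
    show "topspace (prod_topology ?P ?P) \<subseteq> (\<lambda>(x, y). x \<otimes>\<^bsub>K\<^esub> y) -` carrier K"
      using K by (auto simp: tP group.is_monoid monoid.m_closed)
  qed
  ultimately show ?thesis
    using K tP by (simp add: paratopological_group_def)
qed

definition copy_group :: "('h \<Rightarrow> 'w) \<Rightarrow> 'h monoid \<Rightarrow> 'w monoid" where
  "copy_group g H = \<lparr>carrier = g ` carrier H,
     monoid.mult = (\<lambda>x y. g (inv_into (carrier H) g x \<otimes>\<^bsub>H\<^esub> inv_into (carrier H) g y)),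
     one = g \<one>\<^bsub>H\<^esub>\<rparr>"

lemma copy_group:
  assumes "group H" and inj: "inj_on g (carrier H)"
  shows "group (copy_group g H)" "inv_into (carrier H) g \<in> hom (copy_group g H) H"
    "inj_on (inv_into (carrier H) g) (carrier (copy_group g H))"
    "comm_group H \<Longrightarrow> comm_group (copy_group g H)"
proof -
  interpret group H by fact
  show gr: "group (copy_group g H)"
  proof (rule groupI)
    fix x assume "x \<in> carrier (copy_group g H)"
    then obtain a where a: "a \<in> carrier H" "x = g a" by (auto simp: copy_group_def)
    show "\<exists>y\<in>carrier (copy_group g H). y \<otimes>\<^bsub>copy_group g H\<^esub> x = \<one>\<^bsub>copy_group g H\<^esub>"
      by (rule bexI[of _ "g (inv\<^bsub>H\<^esub> a)"]) (use a inj in \<open>auto simp: copy_group_def\<close>)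
  qed (use inj in \<open>auto simp: copy_group_def m_assoc\<close>)
  show "inv_into (carrier H) g \<in> hom (copy_group g H) H"
    using inj by (auto simp: copy_group_def hom_def)
  show "inj_on (inv_into (carrier H) g) (carrier (copy_group g H))"
    by (simp add: copy_group_def inj_on_inv_into)
  assume "comm_group H"
  then interpret H: comm_group H .
  show "comm_group (copy_group g H)"
    by (rule group.group_comm_groupI[OF gr]) (use inj in \<open>auto simp: copy_group_def H.m_comm\<close>)
qed

fun word_value :: "'h monoid \<Rightarrow> ('a \<Rightarrow> 'h) \<Rightarrow> ('a \<times> bool) list \<Rightarrow> 'h" where
  "word_value H f [] = \<one>\<^bsub>H\<^esub>"
| "word_value H f ((x, b) # w) = (if b then f x else inv\<^bsub>H\<^esub> (f x)) \<otimes>\<^bsub>H\<^esub> word_value H f w"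

lemma generate_word_value:
  assumes "group H" "f ` A \<subseteq> carrier H" "y \<in> generate H (f ` A)"
  shows "\<exists>w. set w \<subseteq> A \<times> UNIV \<and> word_value H f w = y"
proof -
  interpret group H by fact
  have closed: "word_value H f w \<in> carrier H" if "set w \<subseteq> A \<times> UNIV" for w
    using that assms(2) by (induction w) auto
  have app: "word_value H f (v @ w) = word_value H f v \<otimes>\<^bsub>H\<^esub> word_value H f w"
    if "set v \<subseteq> A \<times> UNIV" "set w \<subseteq> A \<times> UNIV" for v w
    using that
  proof (induction v)
    case (Cons p v)
    then show ?case
      using assms(2) closed by (cases p) (auto simp: m_assoc image_subset_iff)
  qed (simp add: closed)
  show ?thesis
    using assms(3)
  proof induction
    case one
    show ?case by (rule exI[of _ "[]"]) simp
  next
    case (incl h)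
    then obtain x where "x \<in> A" "h = f x" by blast
    then show ?case using assms(2) by (intro exI[of _ "[(x, True)]"]) auto
  next
    case (inv h)
    then obtain x where "x \<in> A" "h = f x" by blast
    then show ?case using assms(2) by (intro exI[of _ "[(x, False)]"]) auto
  next
    case (eng h1 h2)
    then obtain v w where "set v \<subseteq> A \<times> UNIV" "word_value H f v = h1"
      "set w \<subseteq> A \<times> UNIV" "word_value H f w = h2" by blast
    then show ?case by (intro exI[of _ "v @ w"]) (auto simp: app)
  qed
qed

lemma paratopological_word_copy:
  fixes H :: "'h monoid" and X :: "'a topology"
  assumes H: "paratopological_group H S" and f: "continuous_map X S f"
  obtains K :: "('a \<times> bool) list monoid" and R k f' where
    "paratopological_group K R" "comm_group H \<Longrightarrow> comm_group K" "k \<in> hom K H"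
    "inj_on k (carrier K)" "k ` carrier K = generate H (f ` topspace X)"
    "R = pullback_topology (carrier K) k S"
    "continuous_map R S k" "continuous_map X R f'" "\<And>x. x \<in> topspace X \<Longrightarrow> k (f' x) = f x"
proof -
  interpret group H using H by (simp add: paratopological_group_def)
  have fX: "f ` topspace X \<subseteq> carrier H"
    using H f continuous_map_image_subset_topspace by (fastforce simp: paratopological_group_def)
  define C where "C = generate H (f ` topspace X)"
  have subC: "subgroup C H" unfolding C_def by (rule generate_is_subgroup[OF fX])
  define L where "L = H\<lparr>carrier := C\<rparr>"
  have L: "group L" unfolding L_def by (rule subgroup.subgroup_is_group[OF subC is_group])
  have cL: "carrier L = C" by (simp add: L_def)
  have Lhom: "h \<in> hom K H" if "h \<in> hom K L" for h and K :: "('a \<times> bool) list monoid"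
    using that subgroup.subset[OF subC] by (auto simp: L_def hom_def)
  define g where "g = inv_into UNIV (word_value H f)"
  have inj: "inj_on g (carrier L)"
    unfolding g_def cL using generate_word_value[OF is_group fX]
    by (intro inj_on_inv_into) (auto simp: C_def)
  define K where "K = copy_group g L"
  define k where "k = inv_into (carrier L) g"
  define R where "R = pullback_topology (carrier K) k S"
  note cp = copy_group[OF L inj, folded K_def k_def]
  have kim: "k ` carrier K = C"
    using inj by (force simp: K_def k_def copy_group_def cL image_iff)
  have khom: "k \<in> hom K H" using Lhom cp(2) by blast
  show thesis
  proof (rule that[of K R k "g \<circ> f"])
    show "paratopological_group K R"
      unfolding R_def by (rule paratopological_group_pullback[OF H cp(1) khom cp(3)])
    show "comm_group K" if "comm_group H"
    proof (rule cp(4))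
      interpret A: comm_group H by fact
      show "comm_group L"
        by (rule group.group_comm_groupI[OF L])
           (use subgroup.subset[OF subC] in \<open>auto simp: L_def A.m_comm subset_iff\<close>)
    qed
    show "k \<in> hom K H" "inj_on k (carrier K)" by fact+
    show "k ` carrier K = generate H (f ` topspace X)" using kim by (simp add: C_def)
    show "R = pullback_topology (carrier K) k S" by (rule R_def)
    show "continuous_map R S k"
      using continuous_map_pullback[OF continuous_map_id, of "carrier K" k S]
      by (simp add: R_def id_def o_def)
    show e: "k ((g \<circ> f) x) = f x" if "x \<in> topspace X" for x
      using that inj by (simp add: k_def cL C_def generate.incl)
    show "continuous_map X R (g \<circ> f)"
      unfolding R_def
    proof (rule continuous_map_pullback')
      show "continuous_map X S (k \<circ> (g \<circ> f))"
        by (rule continuous_map_eq[OF f]) (use e in auto)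
      show "topspace X \<subseteq> (g \<circ> f) -` carrier K"
        by (auto simp: K_def copy_group_def cL C_def generate.incl)
    qed
  qed
qed

lemma markov_free_universal:
  fixes H :: "'h monoid"
  assumes G: "markov_free_paratopological_group X G T e"
    and H: "paratopological_group H S" and f: "continuous_map X S f"
  shows "\<exists>h \<in> hom G H. continuous_map T S h \<and> (\<forall>x \<in> topspace X. h (e x) = f x)"
proof -
  obtain K :: "('a \<times> bool) list monoid" and R k f' where
    K: "paratopological_group K R" "k \<in> hom K H"
      "continuous_map R S k" "continuous_map X R f'" "\<And>x. x \<in> topspace X \<Longrightarrow> k (f' x) = f x"
    by (rule paratopological_word_copy[OF H f]) blast
  then obtain h where "h \<in> hom G K" "continuous_map T R h" "\<forall>x \<in> topspace X. h (e x) = f' x"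
    using G unfolding markov_free_paratopological_group_def by blast
  then show ?thesis
    using K by (intro bexI[of _ "k \<circ> h"] conjI) (auto intro: continuous_map_compose simp: hom_def Pi_iff)
qed

lemma markov_free_abelian_universal:
  fixes H :: "'h monoid"
  assumes G: "markov_free_abelian_paratopological_group X G T e"
    and H: "paratopological_group H S" "comm_group H" and f: "continuous_map X S f"
  shows "\<exists>h \<in> hom G H. continuous_map T S h \<and> (\<forall>x \<in> topspace X. h (e x) = f x)"
proof -
  obtain K :: "('a \<times> bool) list monoid" and R k f' where
    K: "paratopological_group K R" "comm_group K" "k \<in> hom K H"
      "continuous_map R S k" "continuous_map X R f'" "\<And>x. x \<in> topspace X \<Longrightarrow> k (f' x) = f x"
    by (rule paratopological_word_copy[OF H(1) f]) (use H(2) in blast)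
  then obtain h where "h \<in> hom G K" "continuous_map T R h" "\<forall>x \<in> topspace X. h (e x) = f' x"
    using G unfolding markov_free_abelian_paratopological_group_def by blast
  then show ?thesis
    using K by (intro bexI[of _ "k \<circ> h"] conjI) (auto intro: continuous_map_compose simp: hom_def Pi_iff)
qed

lemma open_set_test_group:
  fixes X :: "'a topology"
  assumes U: "openin X U"
  obtains H :: "('a \<times> bool) list monoid" and S f W where
    "paratopological_group H S" "comm_group H" "continuous_map X S f" "openin S W"
    "\<And>x. x \<in> topspace X \<Longrightarrow> f x \<in> W \<longleftrightarrow> x \<in> U"
proof -
  define Z where "Z = topology (\<lambda>U :: int set. \<forall>x\<in>U. \<forall>y\<ge>x. y \<in> U)"
  have "istopology (\<lambda>U :: int set. \<forall>x\<in>U. \<forall>y\<ge>x. y \<in> U)"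
    unfolding istopology_def by blast
  then have oZ: "openin Z U \<longleftrightarrow> (\<forall>x\<in>U. \<forall>y\<ge>x. y \<in> U)" for U
    by (simp add: Z_def topology_inverse')
  have tZ: "topspace Z = UNIV"
    using openin_subset[of Z UNIV] by (auto simp: oZ)
  have "t0_space Z"
    unfolding t0_space_def
  proof (intro ballI impI)
    fix x y :: int assume "x \<noteq> y"
    then show "\<exists>U. openin Z U \<and> (x \<notin> U) = (y \<in> U)"
      by (intro exI[of _ "{max x y..}"]) (auto simp: oZ max_def)
  qed
  moreover have "continuous_map (prod_topology Z Z) Z (\<lambda>(x, y). x + y)"
    unfolding continuous_map_def
  proof (intro conjI allI impI)
    fix V assume V: "openin Z V"
    show "openin (prod_topology Z Z) {x \<in> topspace (prod_topology Z Z). (case x of (x, y) \<Rightarrow> x + y) \<in> V}"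
      unfolding openin_prod_topology_alt
    proof (intro allI impI)
      fix a b assume "(a, b) \<in> {x \<in> topspace (prod_topology Z Z). (case x of (x, y) \<Rightarrow> x + y) \<in> V}"
      then have "a + b \<in> V" by simp
      then have "c + d \<in> V" if "c \<ge> a" "d \<ge> b" for c d
        using V that by (meson oZ add_mono)
      then show "\<exists>A B. openin Z A \<and> openin Z B \<and> a \<in> A \<and> b \<in> B \<and>
          A \<times> B \<subseteq> {x \<in> topspace (prod_topology Z Z). (case x of (x, y) \<Rightarrow> x + y) \<in> V}"
        by (intro exI[of _ "{a..}"] exI[of _ "{b..}"]) (auto simp: oZ tZ)
    qed
  qed (simp add: tZ)
  ultimately have Zp: "paratopological_group integer_group Z"
    by (simp add: paratopological_group_def tZ)
  have Zc: "comm_group integer_group"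
    by (rule group.group_comm_groupI) auto
  define f where "f = (\<lambda>x. if x \<in> U then 1 else 0 :: int)"
  have "continuous_map X Z f"
    unfolding continuous_map_def
  proof (intro conjI allI impI)
    fix V assume "openin Z V"
    then have "1 \<in> V" if "0 \<in> V" using that by (force simp: oZ)
    then have "{x \<in> topspace X. f x \<in> V} \<in> {{}, U, topspace X}"
      using openin_subset[OF U] by (auto simp: f_def)
    then consider "{x \<in> topspace X. f x \<in> V} = {}" | "{x \<in> topspace X. f x \<in> V} = U"
      | "{x \<in> topspace X. f x \<in> V} = topspace X" by blast
    then show "openin X {x \<in> topspace X. f x \<in> V}" by cases (simp_all only: openin_empty U openin_topspace)
  qed (simp add: tZ)
  from paratopological_word_copy[OF Zp this]
  obtain K :: "('a \<times> bool) list monoid" and R k f' where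
    K: "paratopological_group K R" "comm_group K"
      "continuous_map R Z k" "continuous_map X R f'" "\<And>x. x \<in> topspace X \<Longrightarrow> k (f' x) = f x"
    using Zc by metis
  show thesis
  proof (rule that[OF K(1,2,4)])
    show "openin R {z \<in> topspace R. k z \<in> {1..}}"
      by (rule openin_continuous_map_preimage[OF K(3)]) (auto simp: oZ)
    show "f' x \<in> {z \<in> topspace R. k z \<in> {1..}} \<longleftrightarrow> x \<in> U" if "x \<in> topspace X" for x
      using that K(4,5) by (auto simp: f_def continuous_map_def)
  qed
qed

lemma paratopological_product_group:
  assumes "\<And>i. i \<in> I \<Longrightarrow> paratopological_group (H i) (S i)"
  shows "paratopological_group (product_group I H) (product_topology S I)"
proof -
  have gr: "group (H i)" and tS: "topspace (S i) = carrier (H i)" and t0: "t0_space (S i)"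
    and m: "continuous_map (prod_topology (S i) (S i)) (S i) (\<lambda>(x, y). x \<otimes>\<^bsub>H i\<^esub> y)"
    if "i \<in> I" for i
    using assms[OF that] by (auto simp: paratopological_group_def)
  have m': "continuous_map (prod_topology (product_topology S I) (product_topology S I)) (S i)
      (\<lambda>p. fst p i \<otimes>\<^bsub>H i\<^esub> snd p i)" if "i \<in> I" for i
  proof -
    have "continuous_map (prod_topology (product_topology S I) (product_topology S I))
        (prod_topology (S i) (S i)) (\<lambda>p. (fst p i, snd p i))"
      by (simp add: continuous_map_pairwise o_def
          continuous_map_compose[OF continuous_map_fst continuous_map_product_projection[OF that, of S], unfolded o_def]
          continuous_map_compose[OF continuous_map_snd continuous_map_product_projection[OF that, of S], unfolded o_def])
    from continuous_map_compose[OF this m[OF that]] show ?thesis by (simp add: o_def)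
  qed
  have "continuous_map (prod_topology (product_topology S I) (product_topology S I))
      (product_topology S I) (\<lambda>p. \<lambda>i\<in>I. fst p i \<otimes>\<^bsub>H i\<^esub> snd p i)"
    by (auto simp: continuous_map_componentwise intro: continuous_map_eq[OF m'])
  then show ?thesis
    using gr t0 by (auto simp: paratopological_group_def t0_space_product_topology tS
        case_prod_unfold cong: PiE_cong)
qed

lemma free_object_exists:
  fixes X :: "'a topology" and ab :: bool
  assumes X: "t0_space X"
  shows "\<exists>(G :: ('a \<times> bool) list monoid) T e.
     paratopological_group G T \<and> (ab \<longrightarrow> comm_group G) \<and> embedding_map X T e \<and>
     generate G (e ` topspace X) = carrier G \<and>
     (\<forall>(H :: ('a \<times> bool) list monoid) S f.
        paratopological_group H S \<and> (ab \<longrightarrow> comm_group H) \<and> continuous_map X S f \<longrightarrow>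
        (\<exists>h \<in> hom G H. continuous_map T S h \<and> (\<forall>x \<in> topspace X. h (e x) = f x)))"
proof -
  define J :: "(('a \<times> bool) list monoid \<times> ('a \<times> bool) list topology \<times> ('a \<Rightarrow> ('a \<times> bool) list)) set"
    where "J = {(H, S, f). paratopological_group H S \<and> (ab \<longrightarrow> comm_group H) \<and> continuous_map X S f}"
  define P where "P = product_group J fst"
  define Q where "Q = product_topology (\<lambda>i. fst (snd i)) J"
  define p where "p = (\<lambda>x. \<lambda>i\<in>J. snd (snd i) x)"
  have PQ: "paratopological_group P Q"
    unfolding P_def Q_def by (rule paratopological_product_group) (auto simp: J_def)
  have grP: "group P" using PQ by (simp add: paratopological_group_def)
  have p: "continuous_map X Q p"
    unfolding Q_def p_def continuous_map_componentwise by (auto simp: J_def)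
  have commP: "comm_group P" if ab
  proof (rule group.group_comm_groupI[OF grP])
    fix x y assume xy: "x \<in> carrier P" "y \<in> carrier P"
    have "x i \<otimes>\<^bsub>fst i\<^esub> y i = y i \<otimes>\<^bsub>fst i\<^esub> x i" if i: "i \<in> J" for i
    proof -
      interpret comm_group "fst i" using i \<open>ab\<close> by (auto simp: J_def)
      show ?thesis using xy i by (auto simp: P_def intro: m_comm)
    qed
    then show "x \<otimes>\<^bsub>P\<^esub> y = y \<otimes>\<^bsub>P\<^esub> x" by (auto simp: P_def)
  qed
  obtain K :: "('a \<times> bool) list monoid" and R k e where
    K: "paratopological_group K R" "comm_group P \<Longrightarrow> comm_group K" "k \<in> hom K P"
      "inj_on k (carrier K)" "k ` carrier K = generate P (p ` topspace X)"
      "continuous_map R Q k" "continuous_map X R e" "\<And>x. x \<in> topspace X \<Longrightarrow> k (e x) = p x"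
    by (rule paratopological_word_copy[OF PQ p]) blast
  have grK: "group K" and tR: "topspace R = carrier K"
    using K(1) by (auto simp: paratopological_group_def)
  have eX: "e ` topspace X \<subseteq> carrier K"
    using K(7) continuous_map_image_subset_topspace tR by fastforce
  have coord: "continuous_map R (fst (snd i)) (\<lambda>z. k z i)" if "i \<in> J" for i
    using continuous_map_compose[OF K(6)[unfolded Q_def] continuous_map_product_projection[OF that]]
    by (simp add: o_def)
  have sep: "\<exists>V. openin R V \<and> (\<forall>x\<in>topspace X. e x \<in> V \<longleftrightarrow> x \<in> U)" if "openin X U" for U
  proof -
    obtain H :: "('a \<times> bool) list monoid" and S f W where
      H: "paratopological_group H S" "comm_group H" "continuous_map X S f" "openin S W"
        "\<And>x. x \<in> topspace X \<Longrightarrow> f x \<in> W \<longleftrightarrow> x \<in> U"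
      by (rule open_set_test_group[OF \<open>openin X U\<close>]) blast
    then have i: "(H, S, f) \<in> J" by (simp add: J_def)
    have "openin R {z \<in> topspace R. k z (H, S, f) \<in> W}"
      using openin_continuous_map_preimage[OF coord[OF i]] H(4) by simp
    then show ?thesis
      using H(5) K(8) i eX tR
      by (intro exI[of _ "{z \<in> topspace R. k z (H, S, f) \<in> W}"]) (auto simp: p_def)
  qed
  have inj: "inj_on e (topspace X)"
  proof (rule inj_onI, rule ccontr)
    fix x y assume xy: "x \<in> topspace X" "y \<in> topspace X" "e x = e y" "x \<noteq> y"
    then obtain U where "openin X U" "x \<notin> U \<longleftrightarrow> y \<in> U"
      using X unfolding t0_space_def by blast
    then show False using sep[of U] xy by metis
  qed
  have "open_map X (subtopology R (e ` topspace X)) e"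
    unfolding open_map_def
  proof (intro allI impI)
    fix U assume U: "openin X U"
    with sep obtain V where V: "openin R V" "\<forall>x\<in>topspace X. e x \<in> V \<longleftrightarrow> x \<in> U" by blast
    then have "e ` U = V \<inter> e ` topspace X" using openin_subset[OF U] by blast
    then show "openin (subtopology R (e ` topspace X)) (e ` U)"
      using V(1) by (auto simp: openin_subtopology)
  qed
  then have emb: "embedding_map X R e"
    unfolding embedding_map_def
    by (intro bijective_open_imp_homeomorphic_map)
       (use K(7) inj eX tR in \<open>auto simp: continuous_map_in_subtopology\<close>)
  have "k ` generate K (e ` topspace X) = generate P (k ` e ` topspace X)"
    using group_hom.generate_img[of K P k "e ` topspace X"] grK grP K(3) eX
    by (simp add: group_hom_def group_hom_axioms_def)
  also have "k ` e ` topspace X = p ` topspace X"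
    using K(8) by (force simp: image_image)
  finally have "k ` generate K (e ` topspace X) = k ` carrier K" by (simp add: K(5))
  then have gen: "generate K (e ` topspace X) = carrier K"
    using inj_on_image_eq_iff[OF K(4)] group.generate_incl[OF grK eX] by blast
  have "\<exists>h \<in> hom K H. continuous_map R S h \<and> (\<forall>x \<in> topspace X. h (e x) = f x)"
    if "paratopological_group H S \<and> (ab \<longrightarrow> comm_group H) \<and> continuous_map X S f"
    for H :: "('a \<times> bool) list monoid" and S f
  proof -
    have i: "(H, S, f) \<in> J" using that by (simp add: J_def)
    show ?thesis
    proof (intro bexI[of _ "\<lambda>z. k z (H, S, f)"] conjI ballI)
      show "continuous_map R S (\<lambda>z. k z (H, S, f))" using coord[OF i] by simp
      show "k (e x) (H, S, f) = f x" if "x \<in> topspace X" for x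
        using K(8)[OF that] i by (simp add: p_def)
      show "(\<lambda>z. k z (H, S, f)) \<in> hom K H"
        using K(3) i by (fastforce simp: hom_def P_def PiE_iff)
    qed
  qed
  with K(1,2) commP emb gen show ?thesis by blast
qed

lemma markov_free_exists:
  fixes X :: "'a topology"
  assumes "t0_space X"
  shows "\<exists>(G :: ('a \<times> bool) list monoid) T e. markov_free_paratopological_group X G T e"
  using free_object_exists[OF assms, of False]
  by (simp add: markov_free_paratopological_group_def)

lemma markov_free_abelian_exists:
  fixes X :: "'a topology"
  assumes "t0_space X"
  shows "\<exists>(A :: ('a \<times> bool) list monoid) T e. markov_free_abelian_paratopological_group X A T e"
  using free_object_exists[OF assms, of True]
  by (simp add: markov_free_abelian_paratopological_group_def)

end

(* If X is a P-space, refine the topology T of the free object by declaring every G_delta-set of T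
   open.  The refinement is again a paratopological group topology, and e stays continuous into it
   because X is a P-space.  By the universal property e extends to a continuous homomorphism from T
   to the refinement; it is the identity on the generators, hence everywhere, so that T already
   contains all its G_delta-sets.  Conversely, X is homeomorphic to a subspace of the free object. *)
theory Submission
  imports Defs
begin

lemma P_space_Inter:
  assumes "P_space X" "\<And>n :: nat. openin X (C n)"
  shows "openin X (\<Inter>(range C))"
proof -
  have "gdelta_in X (\<Inter>(range C))"
    by (rule gdelta_in_Inter) (use assms open_imp_gdelta_in in auto)
  with assms(1) show ?thesis by (simp add: P_space_def)
qed

text \<open>Every G_delta-set is the intersection of a sequence of open sets, so sequences suffice
  as a test.\<close>

lemma P_spaceI:
  assumes "\<And>C :: nat \<Rightarrow> 'a set. (\<And>n. openin X (C n)) \<Longrightarrow> openin X (\<Inter>(range C))"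
  shows "P_space X"
  unfolding P_space_def gdelta_in_descending using assms by blast

text \<open>The G_delta-sets of a subspace are exactly the traces of G_delta-sets of the whole
  space.\<close>

lemma P_space_subtopology:
  assumes "P_space X" shows "P_space (subtopology X S)"
  using assms by (auto simp: P_space_def gdelta_in_subtopology openin_subtopology)

lemma P_space_homeomorphic_map:
  assumes "homeomorphic_map X Y f" "P_space Y" shows "P_space X"
  using assms unfolding P_space_def
  by (meson homeomorphic_map_gdeltaness_eq homeomorphic_map_openness_eq)

lemma P_space_embedding_map:
  assumes "embedding_map X Y f" "P_space Y" shows "P_space X"
  using assms P_space_homeomorphic_map P_space_subtopology unfolding embedding_map_def by blast

text \<open>A point of the intersection has an open box inside each \<open>C n\<close>; intersecting
  the boxes side by side gives one box, whose sides are open because both factors are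
  P-spaces.\<close>

lemma P_space_prod_topology:
  assumes X: "P_space X" and Y: "P_space Y"
  shows "P_space (prod_topology X Y)"
proof (rule P_spaceI)
  fix C :: "nat \<Rightarrow> ('a \<times> 'b) set"
  assume C: "\<And>n. openin (prod_topology X Y) (C n)"
  show "openin (prod_topology X Y) (\<Inter>(range C))"
    unfolding openin_prod_topology_alt
  proof (intro allI impI)
    fix x y assume xy: "(x, y) \<in> \<Inter>(range C)"
    have "\<exists>U V. openin X U \<and> openin Y V \<and> x \<in> U \<and> y \<in> V \<and> U \<times> V \<subseteq> C n" for n
      using C[of n] xy unfolding openin_prod_topology_alt by blast
    then obtain U V where UV: "\<And>n. openin X (U n) \<and> openin Y (V n) \<and> x \<in> U n \<and> y \<in> V n \<and> U n \<times> V n \<subseteq> C n"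
      by metis
    then have "openin X (\<Inter>(range U))" "openin Y (\<Inter>(range V))"
      using P_space_Inter X Y by blast+
    with UV show "\<exists>U V. openin X U \<and> openin Y V \<and> x \<in> U \<and> y \<in> V \<and> U \<times> V \<subseteq> \<Inter>(range C)"
      by (intro exI[of _ "\<Inter>(range U)"] exI[of _ "\<Inter>(range V)"]) blast
  qed
qed

text \<open>The G_delta-sets are closed under binary intersection, so they can serve as a base and
  not merely as a subbase.\<close>

definition P_modification :: "'a topology \<Rightarrow> 'a topology" where
  "P_modification X = topology (\<lambda>S. \<forall>x\<in>S. \<exists>D. gdelta_in X D \<and> x \<in> D \<and> D \<subseteq> S)"

lemma openin_P_modification:
  "openin (P_modification X) S \<longleftrightarrow> (\<forall>x\<in>S. \<exists>D. gdelta_in X D \<and> x \<in> D \<and> D \<subseteq> S)"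
proof -
  have "istopology (\<lambda>S. \<forall>x\<in>S. \<exists>D. gdelta_in X D \<and> x \<in> D \<and> D \<subseteq> S)"
    unfolding istopology_def
  proof (intro conjI allI impI ballI)
    fix S T x
    assume "\<forall>x\<in>S. \<exists>D. gdelta_in X D \<and> x \<in> D \<and> D \<subseteq> S"
      "\<forall>x\<in>T. \<exists>D. gdelta_in X D \<and> x \<in> D \<and> D \<subseteq> T" "x \<in> S \<inter> T"
    then obtain D E where "gdelta_in X D" "x \<in> D" "D \<subseteq> S" "gdelta_in X E" "x \<in> E" "E \<subseteq> T"
      by blast
    then show "\<exists>D. gdelta_in X D \<and> x \<in> D \<and> D \<subseteq> S \<inter> T"
      by (intro exI[of _ "D \<inter> E"]) (auto intro: gdelta_in_Int)
  next
    fix \<K> x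
    assume "\<forall>K\<in>\<K>. \<forall>x\<in>K. \<exists>D. gdelta_in X D \<and> x \<in> D \<and> D \<subseteq> K" "x \<in> \<Union>\<K>"
    then show "\<exists>D. gdelta_in X D \<and> x \<in> D \<and> D \<subseteq> \<Union>\<K>" by (meson UnionE Union_upper order_trans)
  qed
  then show ?thesis by (simp add: P_modification_def topology_inverse')
qed

lemma gdelta_in_imp_openin_P_modification:
  "gdelta_in X S \<Longrightarrow> openin (P_modification X) S"
  by (auto simp: openin_P_modification)

lemma topspace_P_modification [simp]: "topspace (P_modification X) = topspace X"
proof
  show "topspace (P_modification X) \<subseteq> topspace X"
    using openin_topspace[of "P_modification X"] gdelta_in_subset
    unfolding openin_P_modification by blast
  show "topspace X \<subseteq> topspace (P_modification X)"
    by (simp add: gdelta_in_imp_openin_P_modification openin_subset)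
qed

text \<open>Basic neighbourhoods of a point can be intersected countably often, since a countable
  intersection of G_delta-sets is again a G_delta-set.\<close>

lemma P_space_P_modification: "P_space (P_modification X)"
proof (rule P_spaceI)
  fix C :: "nat \<Rightarrow> 'a set" assume C: "\<And>n. openin (P_modification X) (C n)"
  show "openin (P_modification X) (\<Inter>(range C))"
    unfolding openin_P_modification
  proof
    fix x assume "x \<in> \<Inter>(range C)"
    then have "\<exists>D. gdelta_in X D \<and> x \<in> D \<and> D \<subseteq> C n" for n
      using C[of n] unfolding openin_P_modification by blast
    then obtain D where D: "\<And>n. gdelta_in X (D n) \<and> x \<in> D n \<and> D n \<subseteq> C n"
      by metis
    then have "gdelta_in X (\<Inter>(range D))"
      by (intro gdelta_in_Inter) auto
    with D show "\<exists>E. gdelta_in X E \<and> x \<in> E \<and> E \<subseteq> \<Inter>(range C)"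
      by (intro exI[of _ "\<Inter>(range D)"]) blast
  qed
qed

lemma continuous_map_from_P_modification:
  assumes "continuous_map X Y f" shows "continuous_map (P_modification X) Y f"
  using assms
  by (simp add: continuous_map_def gdelta_in_imp_openin_P_modification open_imp_gdelta_in)

text \<open>The preimage of a G_delta-set is a countable intersection of open preimages, hence open
  in the P-space \<open>X\<close>. This is used both for the embedding of generators and for the
  multiplication.\<close>

lemma continuous_map_into_P_modification:
  assumes X: "P_space X" and f: "continuous_map X Y f"
  shows "continuous_map X (P_modification Y) f"
  unfolding continuous_map_def
proof (intro conjI allI impI)
  show "f \<in> topspace X \<rightarrow> topspace (P_modification Y)"
    using f by (simp add: continuous_map_def)
  fix U assume U: "openin (P_modification Y) U"
  show "openin X {x \<in> topspace X. f x \<in> U}"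
  proof (subst openin_subopen, intro ballI)
    fix x assume x: "x \<in> {x \<in> topspace X. f x \<in> U}"
    then obtain D where D: "gdelta_in Y D" "f x \<in> D" "D \<subseteq> U"
      using U unfolding openin_P_modification by blast
    then obtain C where C: "\<And>n :: nat. openin Y (C n)" "\<Inter>(range C) = D"
      unfolding gdelta_in_descending by blast
    have "openin X (\<Inter>n. {x \<in> topspace X. f x \<in> C n})"
      by (rule P_space_Inter[OF X]) (rule openin_continuous_map_preimage[OF f C(1)])
    then show "\<exists>T. openin X T \<and> x \<in> T \<and> T \<subseteq> {x \<in> topspace X. f x \<in> U}"
      using x D C(2) by (intro exI[of _ "\<Inter>n. {x \<in> topspace X. f x \<in> C n}"]) blast
  qed
qed

text \<open>The square of the refined topology is a P-space, so it is enough that multiplication is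
  continuous from it into the original \<open>T\<close>; continuity into the refinement then
  follows. T0 passes to a finer topology.\<close>

lemma paratopological_group_P_modification:
  assumes "paratopological_group G T"
  shows "paratopological_group G (P_modification T)"
proof -
  let ?P = "P_modification T"
  have T: "group G" "topspace T = carrier G" "t0_space T"
    and mult: "continuous_map (prod_topology T T) T (\<lambda>(x, y). x \<otimes>\<^bsub>G\<^esub> y)"
    using assms by (auto simp: paratopological_group_def)
  have "t0_space ?P"
    using T(3) unfolding t0_space_def topspace_P_modification
    by (meson gdelta_in_imp_openin_P_modification open_imp_gdelta_in)
  \<comment> \<open>The identity from the finer square to the coarser one is composed with
    \<open>mult\<close> next.\<close>
  moreover have "continuous_map (prod_topology ?P ?P) (prod_topology T T) (\<lambda>(x, y). (x, y))"
    using continuous_map_prod_top[of ?P ?P T T "\<lambda>x. x" "\<lambda>x. x"]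
      continuous_map_from_P_modification[OF continuous_map_id[of T, unfolded id_def]] by blast
  then have "continuous_map (prod_topology ?P ?P) T (\<lambda>(x, y). x \<otimes>\<^bsub>G\<^esub> y)"
    using continuous_map_compose[OF _ mult] by fastforce
  then have "continuous_map (prod_topology ?P ?P) ?P (\<lambda>(x, y). x \<otimes>\<^bsub>G\<^esub> y)"
    by (intro continuous_map_into_P_modification P_space_prod_topology P_space_P_modification)
  ultimately show ?thesis
    using T by (simp add: paratopological_group_def)
qed

text \<open>The fixed points of an endomorphism form a subgroup. This supplies the uniqueness of
  extensions, which the universal property itself does not state.\<close>

lemma hom_fixes_generate:
  assumes "group G" "h \<in> hom G G" "A \<subseteq> carrier G" "\<And>a. a \<in> A \<Longrightarrow> h a = a" "z \<in> generate G A"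
  shows "h z = z"
proof -
  interpret group_hom G G h
    using assms by (simp add: group_hom_def group_hom_axioms_def)
  show ?thesis
    using assms(5)
  proof induction
    case (eng h1 h2)
    then show ?case using assms(3) by (simp add: G.generate_in_carrier)
  qed (use assms(3,4) in auto)
qed

text \<open>Such an \<open>h\<close> must be the identity, so its continuity says that
  \<open>T\<close> is already as fine as its refinement. It isolates what the general and the
  Abelian case share.\<close>

lemma P_space_if_retracts_to_P_modification:
  assumes T: "paratopological_group G T" and e: "e ` A \<subseteq> carrier G" "generate G (e ` A) = carrier G"
    and h: "h \<in> hom G G" "continuous_map T (P_modification T) h" "\<And>x. x \<in> A \<Longrightarrow> h (e x) = e x"
  shows "P_space T"
  unfolding P_space_def
proof (intro allI impI)
  fix S assume S: "gdelta_in T S"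
  have G: "group G" "topspace T = carrier G"
    using T by (auto simp: paratopological_group_def)
  have "h z = z" if "z \<in> topspace T" for z
    by (rule hom_fixes_generate[OF G(1) h(1) e(1)]) (use that e h(3) G(2) in auto)
  then have "{z \<in> topspace T. h z \<in> S} = S"
    using gdelta_in_subset[OF S] by auto
  then show "openin T S"
    using openin_continuous_map_preimage[OF h(2) gdelta_in_imp_openin_P_modification[OF S]] by simp
qed

lemma embedding_map_imp_continuous_map: "embedding_map X Y f \<Longrightarrow> continuous_map X Y f"
  by (simp add: continuous_map_in_subtopology embedding_map_def homeomorphic_eq_everything_map)

lemma P_space_markov_free_iff:
  assumes free: "markov_free_paratopological_group X G T e"
  shows "P_space T \<longleftrightarrow> P_space X"
proof
  have T: "paratopological_group G T" and e: "embedding_map X T e"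
    and gen: "generate G (e ` topspace X) = carrier G"
    using free by (auto simp: markov_free_paratopological_group_def)
  show "P_space X" if "P_space T"
    using P_space_embedding_map[OF e that] .
  have ce: "continuous_map X T e"
    using e by (rule embedding_map_imp_continuous_map)
  then have eX: "e ` topspace X \<subseteq> carrier G"
    using T continuous_map_image_subset_topspace by (fastforce simp: paratopological_group_def)
  show "P_space T" if "P_space X"
    \<comment> \<open>The target is \<open>G\<close> itself with the refined topology. Its elements
      need not be words, hence the universal property over an arbitrary type.\<close>
    using markov_free_universal[OF free paratopological_group_P_modification[OF T]
        continuous_map_into_P_modification[OF that ce]]
      P_space_if_retracts_to_P_modification[OF T eX gen] by blast
qed

lemma P_space_markov_free_abelian_iff:
  assumes free: "markov_free_abelian_paratopological_group X A T e"
  shows "P_space T \<longleftrightarrow> P_space X"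
proof
  have T: "paratopological_group A T" "comm_group A" and e: "embedding_map X T e"
    and gen: "generate A (e ` topspace X) = carrier A"
    using free by (auto simp: markov_free_abelian_paratopological_group_def)
  show "P_space X" if "P_space T"
    using P_space_embedding_map[OF e that] .
  have ce: "continuous_map X T e"
    using e by (rule embedding_map_imp_continuous_map)
  then have eX: "e ` topspace X \<subseteq> carrier A"
    using T(1) continuous_map_image_subset_topspace by (fastforce simp: paratopological_group_def)
  show "P_space T" if "P_space X"
    \<comment> \<open>Refining the topology leaves the group unchanged, so the target is still
      Abelian.\<close>
    using markov_free_abelian_universal[OF free paratopological_group_P_modification[OF T(1)] T(2)
        continuous_map_into_P_modification[OF that ce]]
      P_space_if_retracts_to_P_modification[OF T(1) eX gen] by blast
qed

theorem theorem3p7: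
  fixes X :: "'a topology"
  assumes "t0_space X"
  shows "(\<forall>(G :: 'g monoid) T e. markov_free_paratopological_group X G T e \<longrightarrow>
            (P_space T \<longleftrightarrow> P_space X)) \<and>
         (\<forall>(A :: 'h monoid) T e. markov_free_abelian_paratopological_group X A T e \<longrightarrow>
            (P_space T \<longleftrightarrow> P_space X))"
  using P_space_markov_free_iff P_space_markov_free_abelian_iff by blast

end
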